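(* Let $p$ be a prime, $r\ge 1$, and let $\mathcal{F}$ be an $(n,w)$-minihyper in $\operatorname{PG}(r,p)$ with $w\equiv n-p\pmod{p^2}$. Assume that: (1) for every hyperplane $H$ of $\operatorname{PG}(r,p)$, $\mathcal{F}(H)\equiv n-p$ or $\mathcal{F}(H)\equiv n\pmod{p^2}$; (2) for every hyperplane $H$ with $\mathcal{F}(H)\equiv n-p\pmod{p^2}$, the restriction $\mathcal{F}|_H$ is reducible to a divisible minihyper with divisor $p$; (3) for every hyperplane $H$ with $\mathcal{F}(H)\equiv n\pmod{p^2}$, the restriction $\mathcal{F}|_H$ is a divisible minihyper with divisor $p$. Then $\mathcal{F}=\mathcal{F}'+\chi_L$, where $L$ is a line of $\operatorname{PG}(r,p)$ and $\mathcal{F}'$ is an $(n-v_2,\,w-v_1)$-minihyper in $\operatorname{PG}(r,p)$, i.e. an $(n-p-1,\,w-1)$-minihyper. Moreover, the line $L$ is uniquely determined.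
   Context: A multiset in $\operatorname{PG}(r,q)$ is a map $\mathcal{K}$ from the point set of $\operatorname{PG}(r,q)$ to the non-negative integers; for a set of points $\mathcal{Q}$, $\mathcal{K}(\mathcal{Q})=\sum_{P\in\mathcal{Q}}\mathcal{K}(P)$. For a set of points $\mathcal{Q}$, $\chi_{\mathcal{Q}}$ is its characteristic function ($1$ on points of $\mathcal{Q}$, $0$ elsewhere). An $(n,w)$-minihyper in $\operatorname{PG}(r,q)$ is a multiset $\mathcal{K}$ with $\mathcal{K}(\text{all points})=n$, $\mathcal{K}(H)\ge w$ for every hyperplane $H$, and $\mathcal{K}(H_0)=w$ for some hyperplane $H_0$. $v_k=(q^k-1)/(q-1)$. For a hyperplane $H$, $\mathcal{F}|_H$ denotes the restriction of $\mathcal{F}$ to the points of $H$, regarded as a multiset in $H\cong\operatorname{PG}(r-1,p)$ (whose hyperplanes are the codimension-2 subspaces of $\operatorname{PG}(r,p)$ contained in $H$). A minihyper of total multiplicity $m$ is divisible with divisor $p$ if every hyperplane of its ambient space has multiplicity $\equiv m\pmod p$. An $(m,u)$-minihyper $\mathcal{G}$ is reducible to a minihyper with a given property if there is a point $P$ with $\mathcal{G}(P)\ge1$ such that $\mathcal{G}-\chi_{\{P\}}$ is an $(m-1,u)$-minihyper with that property.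
   Formalization: Literal uniqueness of L fails (e.g. F = χ_L + p²χ_M in PG(2,p)); what is stated is that L is the unique line for which F' is an (n−p−1, w−1)-minihyper whose restriction to every hyperplane is a divisible minihyper with divisor p. *)

theory Defs
  imports "HOL-Analysis.Cartesian_Space" "HOL-Number_Theory.Cong"
begin

text \<open>
  The geometry PG(r,q) is the lattice of linear subspaces of \<open>'a ^ 'n\<close>, where \<open>'a\<close> is a
  field with q elements and \<open>'n\<close> has r + 1 elements; a projective subspace of
  dimension k is a linear subspace of dimension k + 1.  All notions are relative to an
  ambient linear subspace \<open>W\<close>, so that a hyperplane is itself a projective geometry.
  For \<open>W\<close> a single point the only hyperplane is the zero subspace, which has no points.
\<close>

definition pg_points :: "('a::field ^ 'n) set \<Rightarrow> ('a ^ 'n) set set" where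
  "pg_points W = {P. vec.subspace P \<and> P \<subseteq> W \<and> vec.dim P = 1}"

definition pg_lines :: "('a::field ^ 'n) set \<Rightarrow> ('a ^ 'n) set set" where
  "pg_lines W = {L. vec.subspace L \<and> L \<subseteq> W \<and> vec.dim L = 2}"

definition pg_hyperplanes :: "('a::field ^ 'n) set \<Rightarrow> ('a ^ 'n) set set" where
  "pg_hyperplanes W = {H. vec.subspace H \<and> H \<subseteq> W \<and> vec.dim H + 1 = vec.dim W}"

text \<open>
  A multiset of points of \<open>W\<close> is a function \<open>K\<close> of which only the values on \<open>pg_points W\<close>
  matter.  Hence the restriction of \<open>K\<close> to a hyperplane \<open>H\<close> is \<open>K\<close> considered in the
  ambient space \<open>H\<close>.
\<close>

type_synonym ('a, 'n) pg_multiset = "('a ^ 'n) set \<Rightarrow> nat"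

definition pg_mult :: "('a::field, 'n) pg_multiset \<Rightarrow> ('a ^ 'n) set \<Rightarrow> int" where
  "pg_mult K S = int (\<Sum>P\<in>pg_points S. K P)"

definition chi :: "('a ^ 'n) set set \<Rightarrow> ('a::field, 'n) pg_multiset" where
  "chi Q P = (if P \<in> Q then 1 else 0)"

text \<open>The parameters are integers, so that \<open>w - 1\<close> below is not truncated subtraction.\<close>

definition minihyper ::
    "('a::field ^ 'n) set \<Rightarrow> ('a, 'n) pg_multiset \<Rightarrow> int \<Rightarrow> int \<Rightarrow> bool" where
  "minihyper W K n w \<longleftrightarrow>
     pg_mult K W = n \<and>
     (\<forall>H\<in>pg_hyperplanes W. pg_mult K H \<ge> w) \<and>
     (\<exists>H\<in>pg_hyperplanes W. pg_mult K H = w)"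

definition divisible_minihyper ::
    "nat \<Rightarrow> ('a::field ^ 'n) set \<Rightarrow> ('a, 'n) pg_multiset \<Rightarrow> int \<Rightarrow> int \<Rightarrow> bool" where
  "divisible_minihyper d W K m u \<longleftrightarrow>
     minihyper W K m u \<and> (\<forall>H\<in>pg_hyperplanes W. [pg_mult K H = m] (mod int d))"

text \<open>
  The natural number subtraction is exact, because \<open>G P \<ge> 1\<close>.  The property \<open>\<Phi>\<close> may
  depend on the parameters of the reduced minihyper.
\<close>

definition reducible_to ::
    "(('a, 'n) pg_multiset \<Rightarrow> int \<Rightarrow> int \<Rightarrow> bool) \<Rightarrow>
     ('a::field ^ 'n) set \<Rightarrow> ('a, 'n) pg_multiset \<Rightarrow> int \<Rightarrow> int \<Rightarrow> bool" where
  "reducible_to \<Phi> W G m u \<longleftrightarrow>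
     minihyper W G m u \<and>
     (\<exists>P\<in>pg_points W. G P \<ge> 1 \<and>
        minihyper W (\<lambda>Q. G Q - chi {P} Q) (m - 1) u \<and>
        \<Phi> (\<lambda>Q. G Q - chi {P} Q) (m - 1) u)"

text \<open>The division is exact for \<open>q \<ge> 2\<close>.\<close>

definition v_num :: "nat \<Rightarrow> nat \<Rightarrow> int" where
  "v_num q k = (int q ^ k - 1) div (int q - 1)"

text \<open>
  Uniqueness of the line.  A line \<open>L\<close> such that \<open>F - chi L\<close> is an (n - p - 1, w - 1)-minihyper
  is in general not unique: for two distinct lines \<open>L\<close>, \<open>M\<close> of PG(2,p), the multiset
  \<open>chi L + p^2 chi M\<close> satisfies the hypotheses of the theorem, and both \<open>L\<close> and \<open>M\<close> can be
  split off.  What is unique is the line whose removal carries out the reductions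
  required on the individual hyperplanes, that is, for which \<open>F'\<close> restricts to a divisible
  minihyper with divisor p on every hyperplane; this is how the theorem states it.
\<close>

end

theory Submission
  imports Defs
begin

text \<open>
  Call a hyperplane full if its multiplicity is \<open>n\<close> modulo \<open>p\<^sup>2\<close>, and let the axis be the
  intersection of all full hyperplanes.  Counting over the pencil of hyperplanes through a
  subspace \<open>T\<close> of codimension 2 shows that \<open>T\<close> lies in a full hyperplane as soon as
  \<open>F(T) \<equiv> n\<close> modulo \<open>p\<close>.  In a hyperplane \<open>H\<close> that is not full, the \<open>T\<close> with
  \<open>F(T) \<equiv> n\<close> are exactly those through the point of reduction of \<open>H\<close>; hence \<open>H\<close> meets the
  axis in that point alone.  So the axis is a line all of whose points have positive
  multiplicity, and it is the line to be split off.  It is unique because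
  \<open>F(T) \<equiv> n - 1 + |T \<inter> L|\<close> modulo \<open>p\<close>, for every admissible line \<open>L\<close>, determines which
  \<open>T\<close> are disjoint from \<open>L\<close>.
\<close>

section \<open>Linear algebra of hyperplanes\<close>

lemma vec_dim_span_insert:
  assumes "vec.subspace S" "x \<notin> S"
  shows "vec.dim (vec.span (insert x S)) = vec.dim S + 1"
  using assms by (metis vec.dim_insert vec.dim_span vec.span_eq_iff)

lemma span_insert_eq:
  assumes "vec.subspace T" "vec.subspace H" "T \<subseteq> H" "vec.dim H = vec.dim T + 1" "v \<in> H" "v \<notin> T"
  shows "vec.span (insert v T) = H"
proof (rule vec.subspace_dim_equal)
  show "vec.span (insert v T) \<subseteq> H"
    using assms by (intro vec.span_minimal) auto
  show "vec.dim H \<le> vec.dim (vec.span (insert v T))"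
    using vec_dim_span_insert[OF assms(1,6)] assms(4) by linarith
qed (use assms in \<open>auto simp: vec.subspace_span\<close>)

text \<open>Extend a basis of \<open>S\<close> together with \<open>x\<close> to a basis of
  \<open>W\<close>; the basis vectors other than \<open>x\<close> span the desired hyperplane.
  Hyperplanes with prescribed incidences are chosen in this way throughout.\<close>

lemma hyperplane_separation:
  assumes "vec.subspace S" "vec.subspace W" "S \<subseteq> W" "x \<in> W" "x \<notin> S"
  obtains H where "H \<in> pg_hyperplanes W" "S \<subseteq> H" "x \<notin> H"
proof -
  obtain B where B: "B \<subseteq> S" "vec.independent B" "S \<subseteq> vec.span B"
    using vec.basis_exists by metis
  have "vec.span B = S"
    using B assms(1) by (metis vec.span_subspace)
  then have "x \<notin> vec.span B"
    using assms by simp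
  then have "vec.independent (insert x B)"
    using B(2) by (simp add: vec.independent_insertI)
  moreover have "insert x B \<subseteq> W"
    using B assms by auto
  ultimately obtain C where C: "insert x B \<subseteq> C" "C \<subseteq> W" "vec.independent C" "W \<subseteq> vec.span C"
    using vec.maximal_independent_subset_extend by metis
  let ?H = "vec.span (C - {x})"
  have fC: "finite C"
    using C(3) by (rule vec.finiteI_independent)
  have "vec.dim ?H = card (C - {x})"
    by (meson C(3) Diff_subset vec.dim_span_eq_card_independent vec.independent_mono)
  moreover have "vec.dim W = card C"
    using C by (metis vec.basis_card_eq_dim)
  ultimately have "vec.dim ?H + 1 = vec.dim W"
    using C(1) fC by (metis Suc_eq_plus1 card_Suc_Diff1 insert_subset)
  moreover have "?H \<subseteq> W"
    using C(2) assms(2) by (intro vec.span_minimal) auto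
  ultimately have "?H \<in> pg_hyperplanes W"
    by (simp add: pg_hyperplanes_def vec.subspace_span)
  moreover have "x \<notin> ?H"
    using C(1,3) vec.dependent_def by blast
  moreover have "S \<subseteq> ?H"
  proof -
    have "B \<subseteq> C - {x}"
      using C(1) \<open>x \<notin> vec.span B\<close> vec.span_base by fastforce
    then show ?thesis
      using B(3) vec.span_mono by blast
  qed
  ultimately show thesis
    using that by blast
qed

text \<open>The sum of \<open>H\<close> and \<open>S\<close> stays inside \<open>W\<close>, so the
  dimension formula bounds the drop from \<open>S\<close> to \<open>H \<inter> S\<close> by
  one.\<close>

lemma dim_le_dim_Int_hyperplane:
  assumes "H \<in> pg_hyperplanes W" "vec.subspace W" "vec.subspace S" "S \<subseteq> W"
  shows "vec.dim S \<le> vec.dim (H \<inter> S) + 1"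
proof -
  have H: "vec.subspace H" "H \<subseteq> W" "vec.dim H + 1 = vec.dim W"
    using assms by (auto simp: pg_hyperplanes_def)
  have "vec.dim {x + y |x y. x \<in> H \<and> y \<in> S} + vec.dim (H \<inter> S) = vec.dim H + vec.dim S"
    using H assms by (simp add: vec.dim_sums_Int)
  moreover have "vec.dim {x + y |x y. x \<in> H \<and> y \<in> S} \<le> vec.dim W"
    using H assms by (intro vec.dim_subset) (auto intro!: vec.subspace_add)
  ultimately show ?thesis
    using H(3) by linarith
qed

lemma dim_Int_hyperplane:
  assumes "H \<in> pg_hyperplanes W" "vec.subspace W" "vec.subspace S" "S \<subseteq> W" "\<not> S \<subseteq> H"
  shows "vec.dim (H \<inter> S) + 1 = vec.dim S"
proof -
  have "vec.subspace (H \<inter> S)"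
    using assms by (simp add: pg_hyperplanes_def vec.subspace_inter)
  then have span: "vec.span (H \<inter> S) = H \<inter> S" "vec.span S = S"
    using assms(3) by (simp_all add: vec.span_eq_iff)
  then have "vec.dim (H \<inter> S) < vec.dim S"
    using assms(5) by (intro vec.dim_psubset) (simp only: span, blast)
  then show ?thesis
    using dim_le_dim_Int_hyperplane[OF assms(1-4)] by linarith
qed

section \<open>Counting vectors and pencils of hyperplanes\<close>

lemma card_span_independent:
  fixes B :: "('a::{field,finite} ^ 'n) set"
  assumes "finite B" "vec.independent B"
  shows "card (vec.span B) = CARD('a) ^ card B"
  using assms
proof (induction B)
  case (insert x B)
  have indep: "vec.independent B" and x: "x \<notin> vec.span B"
    using insert.prems insert.hyps by (auto simp: vec.independent_insert)
  let ?f = "\<lambda>(c, t). c *s x + t"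
  \<comment> \<open>The map \<open>?f\<close> is a bijection from pairs of a scalar and a vector of
    \<open>vec.span B\<close> onto the larger span, so each new basis vector multiplies the count by
    the order of the field.\<close>
  have "inj_on ?f (UNIV \<times> vec.span B)"
  proof (rule inj_onI, clarify)
    fix c d s t
    assume s: "s \<in> vec.span B" and t: "t \<in> vec.span B" and eq: "c *s x + s = d *s x + t"
    have "c *s x = d *s x + t - s"
      using eq by (metis add_diff_cancel_right')
    then have "(c - d) *s x = t - s"
      by (simp add: vec.scale_left_diff_distrib)
    then have "(c - d) *s x \<in> vec.span B"
      using s t by (simp add: vec.span_diff)
    \<comment> \<open>A nonzero \<open>c - d\<close> could be inverted, which would put
      \<open>x\<close> into \<open>vec.span B\<close>.\<close>
    then have "c = d"
      using x vec.span_scale[of "(c - d) *s x" B "inverse (c - d)"]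
      by (cases "c = d") (simp_all add: vec.scale_scale del: vec.scale_left_diff_distrib)
    then show "c = d \<and> s = t"
      using eq by simp
  qed
  moreover have "?f ` (UNIV \<times> vec.span B) = vec.span (insert x B)"
  proof (rule set_eqI)
    fix v
    have "v \<in> ?f ` (UNIV \<times> vec.span B) \<longleftrightarrow> (\<exists>k. v - k *s x \<in> vec.span B)"
    proof
      assume "\<exists>k. v - k *s x \<in> vec.span B"
      then obtain k where "v - k *s x \<in> vec.span B" ..
      then show "v \<in> ?f ` (UNIV \<times> vec.span B)"
        by (intro image_eqI[of _ _ "(k, v - k *s x)"]) auto
    next
      assume "v \<in> ?f ` (UNIV \<times> vec.span B)"
      then obtain k t where "t \<in> vec.span B" "v = k *s x + t"
        by auto
      then show "\<exists>k. v - k *s x \<in> vec.span B"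
        by (intro exI[of _ k]) simp
    qed
    then show "v \<in> ?f ` (UNIV \<times> vec.span B) \<longleftrightarrow> v \<in> vec.span (insert x B)"
      by (simp add: vec.span_insert)
  qed
  ultimately have "card (vec.span (insert x B)) = card (UNIV \<times> vec.span B :: ('a \<times> _) set)"
    by (metis card_image)
  then show ?case
    using insert indep by (simp add: card_cartesian_product)
qed simp

lemma card_subspace:
  fixes S :: "('a::{field,finite} ^ 'n) set"
  assumes "vec.subspace S"
  shows "card S = CARD('a) ^ vec.dim S"
proof -
  obtain B where "B \<subseteq> S" "vec.independent B" "S \<subseteq> vec.span B"
    using vec.basis_exists by metis
  then show ?thesis
    by (metis assms card_span_independent vec.basis_card_eq_dim vec.finiteI_independent
        vec.span_subspace)
qed

text \<open>A vector of \<open>W\<close> outside \<open>T\<close> spans together with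
  \<open>T\<close> exactly one member of the pencil, so the sets \<open>H - T\<close> partition
  \<open>W - T\<close>. They all have the same size; with q the order of the field and t the
  dimension of \<open>T\<close>, their number is (q^(t+2) - q^t) / (q^(t+1) - q^t) = q + 1.\<close>

lemma card_pencil:
  fixes T W :: "('a::{field,finite} ^ 'n::finite) set"
  assumes T: "vec.subspace T" "T \<subseteq> W" and W: "vec.subspace W" "vec.dim W = vec.dim T + 2"
  shows "card {H \<in> pg_hyperplanes W. T \<subseteq> H} = CARD('a) + 1"
proof -
  let ?N = "{H \<in> pg_hyperplanes W. T \<subseteq> H}" and ?q = "CARD('a)" and ?t = "vec.dim T"
  have span: "vec.span (insert v T) = H" if "H \<in> ?N" "v \<in> H" "v \<notin> T" for H v
    using that W by (intro span_insert_eq[OF T(1)]) (auto simp: pg_hyperplanes_def)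
  have disj: "(H - T) \<inter> (K - T) = {}" if "H \<in> ?N" "K \<in> ?N" "H \<noteq> K" for H K
    using span[of H] span[of K] that by blast
  have "?q ^ (?t + 2) - ?q ^ ?t = card (W - T)"
    using T W by (simp add: card_Diff_subset card_subspace)
  also have "W - T = (\<Union>H\<in>?N. H - T)"
  proof (intro equalityI subsetI)
    fix v assume v: "v \<in> W - T"
    have "vec.span (insert v T) \<subseteq> W"
      using T W(1) v by (intro vec.span_minimal) auto
    moreover have "vec.dim (vec.span (insert v T)) + 1 = vec.dim W"
      using vec_dim_span_insert[OF T(1), of v] v W(2) by (simp del: vec.dim_span)
    moreover have *: "insert v T \<subseteq> vec.span (insert v T)"
      by (rule vec.span_superset)
    ultimately have "vec.span (insert v T) \<in> ?N"
      unfolding pg_hyperplanes_def using vec.subspace_span by blast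
    with * show "v \<in> (\<Union>H\<in>?N. H - T)"
      using v by blast
  qed (auto simp: pg_hyperplanes_def)
  also have "card \<dots> = (\<Sum>H\<in>?N. card (H - T))"
    by (intro card_UN_disjoint) (use disj in auto)
  also have "\<dots> = (\<Sum>H\<in>?N. ?q ^ (?t + 1) - ?q ^ ?t)"
    using T W by (intro sum.cong) (auto simp: card_Diff_subset card_subspace pg_hyperplanes_def)
  also have "\<dots> = card ?N * (?q ^ (?t + 1) - ?q ^ ?t)"
    by simp
  finally have "card ?N * (?q ^ (?t + 1) - ?q ^ ?t) = ?q ^ (?t + 2) - ?q ^ ?t" ..
  also have "\<dots> = (?q + 1) * (?q ^ (?t + 1) - ?q ^ ?t)"
    by (simp add: algebra_simps diff_mult_distrib2)
  finally have "card ?N * (?q ^ (?t + 1) - ?q ^ ?t) = (?q + 1) * (?q ^ (?t + 1) - ?q ^ ?t)" .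
  moreover have "?q ^ (?t + 1) - ?q ^ ?t > 0"
  proof -
    have "card {0, 1 :: 'a} \<le> ?q"
      by (rule card_mono) auto
    then show ?thesis
      by (simp add: power_strict_increasing)
  qed
  ultimately show ?thesis
    by (simp only: mult_cancel2) linarith
qed

section \<open>Projective points, and the sum of multiplicities over a pencil\<close>

lemma pg_point_subset_iff:
  assumes "P \<in> pg_points W" "vec.subspace S" "v \<in> P" "v \<noteq> 0"
  shows "P \<subseteq> S \<longleftrightarrow> v \<in> S"
proof
  assume "v \<in> S"
  have "vec.span (insert v {0}) = P"
    using assms by (intro span_insert_eq) (auto simp: pg_points_def vec.subspace_0 vec.subspace_def)
  then show "P \<subseteq> S"
    using assms(2) \<open>v \<in> S\<close> vec.span_minimal[of "insert v {0}" S] vec.subspace_0 by blast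
qed (use assms in blast)

lemma pg_pointE:
  assumes "P \<in> pg_points W"
  obtains v where "v \<in> P" "v \<noteq> 0"
proof -
  have "\<not> P \<subseteq> {0}"
    using assms vec.dim_eq_0[of P] by (auto simp: pg_points_def)
  then show thesis
    using that by auto
qed

lemma span_in_pg_points:
  assumes "v \<in> S" "v \<noteq> 0" "vec.subspace S"
  shows "vec.span {v} \<in> pg_points S"
  using assms vec.span_minimal[of "{v}" S] by (simp add: pg_points_def vec.subspace_span)

lemma pg_points_mono: "S \<subseteq> W \<Longrightarrow> pg_points S \<subseteq> pg_points W"
  by (auto simp: pg_points_def)

lemma mem_pg_points_subspace:
  "P \<in> pg_points W \<Longrightarrow> P \<in> pg_points S \<longleftrightarrow> P \<subseteq> S"
  by (auto simp: pg_points_def)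

lemma card_pg_points:
  fixes S :: "('a::{field,finite} ^ 'n::finite) set"
  assumes "vec.subspace S"
  shows "vec.dim S = 1 \<Longrightarrow> card (pg_points S) = 1"
    and "vec.dim S = 2 \<Longrightarrow> card (pg_points S) = CARD('a) + 1"
proof -
  assume "vec.dim S = 1"
  then have "P \<in> pg_points S \<longleftrightarrow> P = S" for P
    using assms vec.subspace_dim_equal[of P S] by (auto simp: pg_points_def)
  then have "pg_points S = {S}"
    by blast
  then show "card (pg_points S) = 1"
    by simp
next
  assume dim: "vec.dim S = 2"
  \<comment> \<open>In dimension 2 the hyperplanes are the points, so the points of a line form the
    pencil through the zero subspace.\<close>
  have "pg_points S = {H \<in> pg_hyperplanes S. {0} \<subseteq> H}"
    unfolding pg_points_def pg_hyperplanes_def using dim vec.subspace_0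
    by (intro Collect_cong) auto
  also have "card \<dots> = CARD('a) + 1"
    using dim assms by (intro card_pencil) (auto simp: vec.subspace_0 vec.subspace_def)
  finally show "card (pg_points S) = CARD('a) + 1" .
qed

text \<open>Double counting: a point of \<open>T\<close> lies in all q + 1 members of the pencil, a
  point outside \<open>T\<close> only in the one that it spans with \<open>T\<close>. So every point
  of \<open>W\<close> is counted once, and those of \<open>T\<close> another q times.\<close>

lemma sum_pg_mult_pencil:
  fixes T W :: "('a::{field,finite} ^ 'n::finite) set"
  assumes T: "vec.subspace T" "T \<subseteq> W" and W: "vec.subspace W" "vec.dim W = vec.dim T + 2"
  shows "(\<Sum>H | H \<in> pg_hyperplanes W \<and> T \<subseteq> H. pg_mult F H)
    = pg_mult F W + int CARD('a) * pg_mult F T"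
proof -
  let ?N = "{H \<in> pg_hyperplanes W. T \<subseteq> H}"
  have count: "card {H \<in> ?N. P \<in> pg_points H} = 1 + CARD('a) * of_bool (P \<in> pg_points T)"
    if P: "P \<in> pg_points W" for P
  proof (cases "P \<subseteq> T")
    case True
    then have "{H \<in> ?N. P \<in> pg_points H} = ?N"
      using P by (auto simp: pg_points_def)
    then show ?thesis
      using True card_pencil[OF T W] P by (simp add: mem_pg_points_subspace)
  next
    case False
    then obtain v where v: "v \<in> P" "v \<notin> T" "v \<in> W"
      using P by (auto simp: pg_points_def)
    then have v0: "v \<noteq> 0"
      using T(1) vec.subspace_0 by metis
    have "{H \<in> ?N. P \<in> pg_points H} = {vec.span (insert v T)}"
    proof (rule set_eqI, unfold singleton_iff)
      fix H
      show "H \<in> {H \<in> ?N. P \<in> pg_points H} \<longleftrightarrow> H = vec.span (insert v T)"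
      proof
        assume "H \<in> {H \<in> ?N. P \<in> pg_points H}"
        then show "H = vec.span (insert v T)"
          using v T W by (intro span_insert_eq[symmetric]) (auto simp: pg_hyperplanes_def pg_points_def)
      next
        assume H: "H = vec.span (insert v T)"
        have "H \<subseteq> W"
          unfolding H using T W(1) v by (intro vec.span_minimal) auto
        moreover have sub: "vec.subspace H" "insert v T \<subseteq> H"
          unfolding H by (rule vec.subspace_span, rule vec.span_superset)
        moreover have "vec.dim H + 1 = vec.dim W"
          using vec_dim_span_insert[OF T(1) v(2)] W(2) unfolding H by (simp del: vec.dim_span)
        moreover have "P \<in> pg_points H"
          using sub v v0 P by (simp add: mem_pg_points_subspace[OF P] pg_point_subset_iff[OF P])
        ultimately show "H \<in> {H \<in> ?N. P \<in> pg_points H}"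
          by (simp add: pg_hyperplanes_def)
      qed
    qed
    then show ?thesis
      using False P by (simp add: mem_pg_points_subspace[OF P])
  qed
  \<comment> \<open>Every sum is written over all points of \<open>W\<close> with an indicator, so
    that the summations over hyperplanes and over points can be interchanged.\<close>
  have restr: "(\<Sum>P\<in>pg_points S. F P) = (\<Sum>P\<in>pg_points W. of_bool (P \<in> pg_points S) * F P)"
    if "S \<subseteq> W" for S
    by (rule sum.mono_neutral_cong_left) (use pg_points_mono[OF that] in auto)
  have "(\<Sum>H\<in>?N. \<Sum>P\<in>pg_points H. F P)
    = (\<Sum>H\<in>?N. \<Sum>P\<in>pg_points W. of_bool (P \<in> pg_points H) * F P)"
    by (intro sum.cong restr) (auto simp: pg_hyperplanes_def)
  also have "\<dots> = (\<Sum>P\<in>pg_points W. (\<Sum>H\<in>?N. of_bool (P \<in> pg_points H)) * F P)"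
    by (subst sum.swap) (simp add: sum_distrib_right)
  also have "\<dots> = (\<Sum>P\<in>pg_points W. (1 + CARD('a) * of_bool (P \<in> pg_points T)) * F P)"
    by (intro sum.cong refl arg_cong2[of _ _ _ _ "(*)"]) (use count in \<open>simp add: Int_def\<close>)
  also have "\<dots> = (\<Sum>P\<in>pg_points W. F P) + CARD('a) * (\<Sum>P\<in>pg_points T. F P)"
    unfolding restr[OF T(2)] by (simp add: algebra_simps sum.distrib sum_distrib_left
        del: sum_of_bool_mult_eq sum_mult_of_bool_eq)
  finally show ?thesis
    unfolding pg_mult_def of_nat_sum[symmetric] of_nat_mult[symmetric] of_nat_add[symmetric]
    by (simp only:)
qed

section \<open>Removal of points and lines, divisibility, and a criterion for equality of
  lines\<close>

lemma pg_hyperplanesD: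
  assumes "H \<in> pg_hyperplanes W"
  shows "vec.subspace H" "H \<subseteq> W" "vec.dim H + 1 = vec.dim W"
  using assms by (auto simp: pg_hyperplanes_def)

lemma pg_hyperplanes_nonempty:
  assumes "vec.subspace W" "vec.dim W \<noteq> 0"
  shows "pg_hyperplanes W \<noteq> {}"
proof -
  obtain x where "x \<in> W" "x \<noteq> 0"
    using assms(2) by (auto simp: vec.dim_eq_0)
  then show ?thesis
    using hyperplane_separation[of "{0}" W x] assms(1) vec.subspace_0[OF assms(1)] vec.subspace_single_0
    by blast
qed

lemma pg_points_Int: "pg_points (S \<inter> T) = pg_points S \<inter> pg_points T"
  by (auto simp: pg_points_def)

lemma pg_points_point:
  assumes "P \<in> pg_points W"
  shows "pg_points P = {P}"
proof -
  have "Q = P" if "vec.subspace Q" "Q \<subseteq> P" "vec.dim Q = 1" for Q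
    using that assms by (intro vec.subspace_dim_equal) (auto simp: pg_points_def)
  then show ?thesis
    using assms by (auto simp: pg_points_def)
qed

text \<open>Both 1 and q + 1 are 1 modulo q, so modulo q it does not matter whether a subspace cuts
  a line in a point or contains it.\<close>

lemma card_pg_points_cong_1:
  fixes S :: "('a::{field,finite} ^ 'n::finite) set"
  assumes "vec.subspace S" "vec.dim S = 1 \<or> vec.dim S = 2"
  shows "[int (card (pg_points S)) = 1] (mod int CARD('a))"
  using assms card_pg_points[OF assms(1)] by (auto simp: cong_iff_dvd_diff)

lemma pg_mult_add_chi:
  fixes F F' :: "('a::{field,finite}, 'n::finite) pg_multiset"
  assumes "\<And>P. P \<in> pg_points S \<Longrightarrow> F P = F' P + chi (pg_points L) P"
  shows "pg_mult F S = pg_mult F' S + int (card (pg_points (S \<inter> L)))"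
proof -
  have "(\<Sum>P\<in>pg_points S. F P) = (\<Sum>P\<in>pg_points S. F' P + of_bool (P \<in> pg_points L))"
    using assms by (intro sum.cong) (auto simp: chi_def)
  also have "\<dots> = (\<Sum>P\<in>pg_points S. F' P) + card (pg_points (S \<inter> L))"
    by (simp add: sum.distrib pg_points_Int)
  finally show ?thesis
    by (simp add: pg_mult_def)
qed

lemma pg_mult_diff_point:
  fixes F :: "('a::{field,finite}, 'n::finite) pg_multiset"
  assumes "P \<in> pg_points W" "F P \<ge> 1"
  shows "pg_mult (\<lambda>Q. F Q - chi {P} Q) S = pg_mult F S - of_bool (P \<subseteq> S)"
proof -
  \<comment> \<open>Removing the point \<open>P\<close> is the special case \<open>L = P\<close>,
    because \<open>P\<close> is its own only point.\<close>
  have "pg_mult F S = pg_mult (\<lambda>Q. F Q - chi {P} Q) S + int (card (pg_points (S \<inter> P)))"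
    using assms by (intro pg_mult_add_chi) (auto simp: chi_def pg_points_point)
  also have "pg_points (S \<inter> P) = (if P \<subseteq> S then {P} else {})"
    using pg_points_point[OF assms(1)] mem_pg_points_subspace[OF assms(1)]
    by (auto simp: pg_points_Int)
  finally show ?thesis
    by simp
qed

text \<open>A minihyper must attain its bound \<open>u\<close>. The least hyperplane multiplicity
  serves, since a nonzero \<open>W\<close> has hyperplanes, and only finitely many.\<close>

lemma divisible_minihyperI:
  fixes K :: "('a::{field,finite}, 'n::finite) pg_multiset"
  assumes "vec.subspace W" "vec.dim W \<noteq> 0"
    and "\<And>H. H \<in> pg_hyperplanes W \<Longrightarrow> [pg_mult K H = pg_mult K W] (mod int d)"
  shows "\<exists>m u. divisible_minihyper d W K m u"
proof -
  let ?M = "pg_mult K ` pg_hyperplanes W"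
  have "finite ?M" "?M \<noteq> {}"
    using pg_hyperplanes_nonempty[OF assms(1,2)] by simp_all
  then have "Min ?M \<in> ?M" "\<forall>k\<in>?M. Min ?M \<le> k"
    by simp_all
  then have "minihyper W K (pg_mult K W) (Min ?M)"
    unfolding minihyper_def by fastforce
  then show ?thesis
    using assms(3) unfolding divisible_minihyper_def by blast
qed

text \<open>If \<open>M\<close> had a vector \<open>x\<close> outside \<open>L\<close>, some
  \<open>T\<close> of codimension 2 would contain \<open>x\<close> and miss \<open>L\<close>. Then
  \<open>L\<close> makes \<open>f T\<close> congruent to \<open>c\<close>, while \<open>M\<close>
  makes it congruent to \<open>c + 1\<close>.\<close>

lemma line_eq_of_codim2_cong:
  fixes L M :: "('a::{field,finite} ^ 'n::finite) set"
  assumes L: "L \<in> pg_lines UNIV" and M: "M \<in> pg_lines UNIV"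
    and congL: "\<And>H T. H \<in> pg_hyperplanes UNIV \<Longrightarrow> T \<in> pg_hyperplanes H \<Longrightarrow>
      [f T = c + int (card (pg_points (T \<inter> L)))] (mod int CARD('a))"
    and congM: "\<And>H T. H \<in> pg_hyperplanes UNIV \<Longrightarrow> T \<in> pg_hyperplanes H \<Longrightarrow>
      [f T = c + int (card (pg_points (T \<inter> M)))] (mod int CARD('a))"
  shows "L = M"
proof -
  have Ls: "vec.subspace L" "vec.dim L = 2" and Ms: "vec.subspace M" "vec.dim M = 2"
    using L M by (auto simp: pg_lines_def)
  have "M \<subseteq> L"
  proof (rule subsetI, rule ccontr)
    fix x assume x: "x \<in> M" "x \<notin> L"
    then have x0: "x \<noteq> 0"
      using Ls(1) vec.subspace_0 by metis
    let ?X = "vec.span {x}"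
    have X: "?X \<in> pg_points UNIV" "vec.subspace ?X" "x \<in> ?X"
      using x0 by (simp_all add: span_in_pg_points vec.subspace_span vec.span_base)
    have notX: "y \<notin> ?X" if "y \<in> L" "y \<noteq> 0" for y
      using pg_point_subset_iff[OF X(1) Ls(1), of y] X(3) x(2) that by blast
    obtain y where y: "y \<in> L" "y \<noteq> 0"
      using Ls(2) vec.dim_eq_0[of L] by auto
    \<comment> \<open>A hyperplane through \<open>x\<close> but not through \<open>y\<close> does
      not contain \<open>L\<close>, hence cuts it in a single point.\<close>
    obtain H where H: "H \<in> pg_hyperplanes UNIV" "?X \<subseteq> H" "y \<notin> H"
      by (rule hyperplane_separation[of ?X UNIV y]) (use X notX[OF y] in \<open>simp_all add: vec.subspace_UNIV\<close>)
    note Hs = pg_hyperplanesD[OF H(1)]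
    have "vec.dim (H \<inter> L) + 1 = vec.dim L"
      using H y Ls by (intro dim_Int_hyperplane[OF H(1)]) (auto simp: vec.subspace_UNIV)
    then have Q: "H \<inter> L \<in> pg_points UNIV"
      using Hs Ls by (simp add: pg_points_def vec.subspace_inter)
    obtain z where z: "z \<in> H" "z \<in> L" "z \<noteq> 0"
      using pg_pointE[OF Q] by blast
    \<comment> \<open>Inside \<open>H\<close> it suffices to avoid that one point, represented by
      \<open>z\<close>.\<close>
    obtain T where T: "T \<in> pg_hyperplanes H" "?X \<subseteq> T" "z \<notin> T"
      by (rule hyperplane_separation[of ?X H z]) (use X H z Hs notX in simp_all)
    note Ts = pg_hyperplanesD[OF T(1)]
    have "pg_points (T \<inter> L) \<subseteq> pg_points T \<inter> pg_points (H \<inter> L)"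
      using Ts(2) by (auto simp: pg_points_def)
    also have "\<dots> = pg_points T \<inter> {H \<inter> L}"
      by (simp only: pg_points_point[OF Q])
    also have "\<dots> = {}"
      using z T(3) by (auto simp: pg_points_def)
    finally have "card (pg_points (T \<inter> L)) = 0"
      by simp
    then have 0: "[f T = c] (mod int CARD('a))"
      using congL[OF H(1) T(1)] by simp
    have "x \<in> T \<inter> M"
      using T(2) X(3) x(1) by auto
    then have "vec.dim (T \<inter> M) \<noteq> 0"
      using x0 by (auto simp: vec.dim_eq_0)
    moreover have "vec.dim (T \<inter> M) \<le> 2"
      using Ms(2) vec.dim_subset[of "T \<inter> M" M] by simp
    ultimately have "vec.dim (T \<inter> M) = 1 \<or> vec.dim (T \<inter> M) = 2"
      by linarith
    then have "[int (card (pg_points (T \<inter> M))) = 1] (mod int CARD('a))"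
      using Ts Ms by (intro card_pg_points_cong_1) (auto simp: vec.subspace_inter)
    then have "[f T = c + 1] (mod int CARD('a))"
      using congM[OF H(1) T(1)] by (meson cong_add_lcancel cong_trans)
    then have "[c = c + 1] (mod int CARD('a))"
      using 0 by (meson cong_sym cong_trans)
    then have "CARD('a) = 1"
      by (simp add: cong_iff_dvd_diff zdvd1_eq)
    moreover have "card {0, 1 :: 'a} \<le> CARD('a)"
      by (rule card_mono) auto
    ultimately show False
      by simp
  qed
  then show ?thesis
    using Ls Ms by (intro vec.subspace_dim_equal[symmetric]) auto
qed

section \<open>Full hyperplanes and multiplicities modulo \<open>p\<close>\<close>

locale decomposable_minihyper =
  fixes F :: "('a::{field,finite}, 'n::finite) pg_multiset"
    and p :: nat and n w :: int
  assumes card_field: "CARD('a) = p"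
    and card_index: "CARD('n) \<ge> 2"
    and minihyper: "minihyper UNIV F n w"
    and w_cong: "[w = n - int p] (mod (int p)\<^sup>2)"
    and mult_cong: "\<And>H. H \<in> pg_hyperplanes UNIV \<Longrightarrow>
      [pg_mult F H = n - int p] (mod (int p)\<^sup>2) \<or> [pg_mult F H = n] (mod (int p)\<^sup>2)"
    and reducible: "\<And>H. H \<in> pg_hyperplanes UNIV \<Longrightarrow>
      [pg_mult F H = n - int p] (mod (int p)\<^sup>2) \<Longrightarrow>
      \<exists>m u. reducible_to (divisible_minihyper p H) H F m u"
    and divisible: "\<And>H. H \<in> pg_hyperplanes UNIV \<Longrightarrow>
      [pg_mult F H = n] (mod (int p)\<^sup>2) \<Longrightarrow>
      \<exists>m u. divisible_minihyper p H F m u"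
begin

definition full :: "('a ^ 'n) set set" where
  "full = {H \<in> pg_hyperplanes UNIV. [pg_mult F H = n] (mod (int p)\<^sup>2)}"

text \<open>For r = 1 no hyperplane is full, and the intersection of the empty family is then the
  whole space, which is the only line.\<close>

definition axis :: "('a ^ 'n) set" where
  "axis = \<Inter>full"

lemma p_ge_2: "p \<ge> 2"
proof -
  have "card {0, 1 :: 'a} \<le> CARD('a)"
    by (rule card_mono) auto
  then show ?thesis
    using card_field by simp
qed

text \<open>As r is at least 1, a hyperplane contains a point and therefore has hyperplanes of its
  own, as a minihyper on it requires.\<close>

lemma dim_hyperplane:
  fixes H :: "('a ^ 'n) set"
  assumes "H \<in> pg_hyperplanes UNIV"
  shows "vec.dim H \<noteq> 0"
  using pg_hyperplanesD(3)[OF assms] card_index unfolding vec_dim_card by linarith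

text \<open>The two admissible residues are distinct, since \<open>p \<ge> 2\<close> is not
  divisible by its square.\<close>

lemma not_full_iff:
  assumes "H \<in> pg_hyperplanes UNIV"
  shows "H \<notin> full \<longleftrightarrow> [pg_mult F H = n - int p] (mod (int p)\<^sup>2)"
proof -
  have "\<not> (int p)\<^sup>2 dvd int p"
    using p_ge_2 by (auto simp: power2_eq_square dest: zdvd_imp_le)
  then have "\<not> [n = n - int p] (mod (int p)\<^sup>2)"
    by (simp add: cong_iff_dvd_diff)
  then show ?thesis
    using mult_cong[OF assms] assms unfolding full_def by (blast intro: cong_trans cong_sym)
qed

lemma mult_hyperplane_cong:
  assumes "H \<in> pg_hyperplanes UNIV"
  shows "[pg_mult F H = n] (mod int p)"
proof -
  have dvd: "int p dvd (int p)\<^sup>2"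
    by simp
  have "[pg_mult F H = n - int p] (mod int p) \<or> [pg_mult F H = n] (mod int p)"
    using mult_cong[OF assms] cong_dvd_modulus[OF _ dvd] by blast
  moreover have "[n - int p = n] (mod int p)"
    by (simp add: cong_iff_dvd_diff)
  ultimately show ?thesis
    by (blast intro: cong_trans)
qed

lemma mult_codim2_full:
  assumes "H \<in> full" "T \<in> pg_hyperplanes H"
  shows "[pg_mult F T = n] (mod int p)"
proof -
  have H: "H \<in> pg_hyperplanes UNIV"
    using assms(1) by (simp add: full_def)
  obtain m u where "divisible_minihyper p H F m u"
    using divisible assms(1) unfolding full_def by blast
  then have "[pg_mult F T = pg_mult F H] (mod int p)"
    using assms(2) by (auto simp: divisible_minihyper_def minihyper_def)
  then show ?thesis
    using mult_hyperplane_cong[OF H] by (rule cong_trans)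
qed

text \<open>After removal of the point of reduction, divisibility makes every hyperplane of
  \<open>H\<close> congruent to the reduced total, which is \<open>n - 1\<close> modulo
  \<open>p\<close>. The point is counted back exactly for those \<open>T\<close> that contain
  it.\<close>

lemma not_full_point:
  assumes "H \<in> pg_hyperplanes UNIV" "H \<notin> full"
  obtains P where "P \<in> pg_points H" "F P \<ge> 1"
    "\<And>T. T \<in> pg_hyperplanes H \<Longrightarrow> [pg_mult F T = n - 1 + of_bool (P \<subseteq> T)] (mod int p)"
proof -
  obtain m u where red: "reducible_to (divisible_minihyper p H) H F m u"
    using reducible not_full_iff assms by blast
  then have m: "pg_mult F H = m"
    by (simp add: reducible_to_def minihyper_def)
  obtain P where P: "P \<in> pg_points H" "F P \<ge> 1"
    and div: "divisible_minihyper p H (\<lambda>Q. F Q - chi {P} Q) (m - 1) u"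
    using red unfolding reducible_to_def by blast
  have "[pg_mult F T = n - 1 + of_bool (P \<subseteq> T)] (mod int p)" if T: "T \<in> pg_hyperplanes H" for T
  proof -
    have "[pg_mult (\<lambda>Q. F Q - chi {P} Q) T = m - 1] (mod int p)"
      using div T unfolding divisible_minihyper_def by blast
    then have "[pg_mult F T - of_bool (P \<subseteq> T) = m - 1] (mod int p)"
      by (simp only: pg_mult_diff_point[of P H F, OF P])
    moreover have "[m - 1 = n - 1] (mod int p)"
      using mult_hyperplane_cong[OF assms(1)] m by (simp add: cong_diff)
    ultimately have "[pg_mult F T - of_bool (P \<subseteq> T) = n - 1] (mod int p)"
      by (rule cong_trans)
    then show ?thesis
      by (simp add: cong_iff_dvd_diff algebra_simps)
  qed
  then show thesis
    using that P by blast
qed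

text \<open>
  If no hyperplane of the pencil of \<open>T\<close> were full, then summing over the pencil would give
  \<open>(p + 1) (n - p) \<equiv> n + p F(T)\<close> modulo \<open>p\<^sup>2\<close>, that is, \<open>F(T) \<equiv> n - 1\<close> modulo \<open>p\<close>.
\<close>

lemma full_hyperplane_above:
  assumes H: "H \<in> pg_hyperplanes UNIV" and T: "T \<in> pg_hyperplanes H"
    and mult: "[pg_mult F T = n] (mod int p)"
  obtains K where "K \<in> full" "T \<subseteq> K"
proof (rule ccontr)
  assume "\<not> thesis"
  then have not_full: "\<And>K. T \<subseteq> K \<Longrightarrow> K \<notin> full"
    using that by blast
  let ?N = "{K \<in> pg_hyperplanes UNIV. T \<subseteq> K}"
  note Hs = pg_hyperplanesD[OF H] and Ts = pg_hyperplanesD[OF T]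
  have dim: "vec.dim (UNIV :: ('a ^ 'n) set) = vec.dim T + 2"
    using Hs(3) Ts(3) by linarith
  have "[\<Sum>K\<in>?N. pg_mult F K = (\<Sum>K\<in>?N. n - int p)] (mod (int p)\<^sup>2)"
    using not_full not_full_iff by (intro cong_sum) blast
  moreover have "card ?N = p + 1"
    using card_pencil[OF Ts(1) _ _ dim] card_field by (simp add: vec.subspace_UNIV)
  then have "(\<Sum>K\<in>?N. n - int p) = int (p + 1) * (n - int p)"
    by (simp only: sum_constant)
  moreover have "(\<Sum>K\<in>?N. pg_mult F K) = n + int p * pg_mult F T"
    using sum_pg_mult_pencil[OF Ts(1) _ _ dim, of F] card_field minihyper
    by (simp add: vec.subspace_UNIV minihyper_def)
  ultimately have dvd: "(int p)\<^sup>2 dvd n + int p * pg_mult F T - int (p + 1) * (n - int p)"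
    by (simp only: cong_iff_dvd_diff)
  obtain k where "pg_mult F T - n = int p * k"
    using mult by (auto simp: cong_iff_dvd_diff)
  then have k: "pg_mult F T = n + int p * k"
    by linarith
  have "n + int p * pg_mult F T - int (p + 1) * (n - int p) = (int p)\<^sup>2 * (k + 1) + int p"
    unfolding k by (simp add: algebra_simps power2_eq_square)
  then have "(int p)\<^sup>2 dvd int p"
    using dvd by (simp add: dvd_add_right_iff)
  then show False
    using p_ge_2 by (auto simp: power2_eq_square dest: zdvd_imp_le)
qed

section \<open>The axis is a line with points of positive multiplicity\<close>

lemma subspace_axis: "vec.subspace axis"
  unfolding axis_def by (rule vec.subspace_Inter) (auto simp: full_def pg_hyperplanes_def)

lemma not_full_Int_axis:
  assumes H: "H \<in> pg_hyperplanes UNIV" and not_full: "H \<notin> full"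
    and P: "P \<in> pg_points H"
    and mult: "\<And>T. T \<in> pg_hyperplanes H \<Longrightarrow> [pg_mult F T = n - 1 + of_bool (P \<subseteq> T)] (mod int p)"
  shows "H \<inter> axis = P"
proof -
  note Hs = pg_hyperplanesD[OF H]
  have Ps: "vec.subspace P" "P \<subseteq> H"
    using P by (auto simp: pg_points_def)
  \<comment> \<open>A full \<open>K\<close> differs from \<open>H\<close> and has the same
    dimension, so \<open>H \<inter> K\<close> is a hyperplane of both, and the congruences coming
    from \<open>H\<close> and from \<open>K\<close> both apply to it.\<close>
  have cut: "H \<inter> K \<in> pg_hyperplanes H" "H \<inter> K \<in> pg_hyperplanes K" if K: "K \<in> full" for K
  proof -
    have K': "K \<in> pg_hyperplanes UNIV"
      using K by (simp add: full_def)
    note Ks = pg_hyperplanesD[OF K']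
    have dims: "vec.dim K = vec.dim H"
      using Ks(3) Hs(3) by linarith
    have "\<not> H \<subseteq> K"
      using vec.subspace_dim_equal[OF Hs(1) Ks(1)] dims K not_full by auto
    then have "vec.dim (K \<inter> H) + 1 = vec.dim H"
      using Hs by (intro dim_Int_hyperplane[OF K']) (simp_all add: vec.subspace_UNIV)
    then have "H \<inter> K \<in> pg_hyperplanes H \<and> H \<inter> K \<in> pg_hyperplanes K"
      unfolding pg_hyperplanes_def using Hs(1) Ks(1) dims by (simp add: vec.subspace_inter Int_commute)
    then show "H \<inter> K \<in> pg_hyperplanes H" "H \<inter> K \<in> pg_hyperplanes K"
      by simp_all
  qed
  \<comment> \<open>The multiplicity of \<open>H \<inter> K\<close> is \<open>n\<close> modulo
    \<open>p\<close> because \<open>K\<close> is full, but would be \<open>n - 1\<close> if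
    \<open>K\<close> missed \<open>P\<close>.\<close>
  have "P \<subseteq> K" if K: "K \<in> full" for K
  proof (rule ccontr)
    assume "\<not> P \<subseteq> K"
    then have "[pg_mult F (H \<inter> K) = n - 1] (mod int p)"
      using mult[OF cut(1)[OF K]] by simp
    moreover have "[pg_mult F (H \<inter> K) = n] (mod int p)"
      using mult_codim2_full[OF K cut(2)[OF K]] .
    ultimately have "[n = n - 1] (mod int p)"
      by (meson cong_sym cong_trans)
    then show False
      using p_ge_2 by (simp add: cong_iff_dvd_diff zdvd1_eq)
  qed
  \<comment> \<open>Choose \<open>T\<close> through \<open>P\<close> but not through
    \<open>x\<close>. Its residue \<open>n\<close> yields a full \<open>K\<close> above it, and
    \<open>K\<close> cuts \<open>H\<close> exactly in \<open>T\<close>, so \<open>x\<close> is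
    outside \<open>K\<close> and hence off the axis.\<close>
  moreover have "x \<in> P" if x: "x \<in> H" "x \<in> axis" for x
  proof (rule ccontr)
    assume "x \<notin> P"
    then obtain T where T: "T \<in> pg_hyperplanes H" "P \<subseteq> T" "x \<notin> T"
      using hyperplane_separation[OF Ps(1) Hs(1) Ps(2) x(1)] by blast
    then have "[pg_mult F T = n] (mod int p)"
      using mult[OF T(1)] by simp
    then obtain K where K: "K \<in> full" "T \<subseteq> K"
      using full_hyperplane_above[OF H T(1)] by blast
    note Ts = pg_hyperplanesD[OF T(1)] and HKs = pg_hyperplanesD[OF cut(1)[OF K(1)]]
    have "T = H \<inter> K"
      using Ts HKs K(2) by (intro vec.subspace_dim_equal) auto
    then show False
      using x T(3) K(1) by (auto simp: axis_def)
  qed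
  ultimately show ?thesis
    using Ps(2) unfolding axis_def by blast
qed

text \<open>The minimum \<open>w\<close> has the residue of \<open>n - p\<close>, so no hyperplane
  attaining it is full.\<close>

lemma ex_not_full:
  obtains H where "H \<in> pg_hyperplanes UNIV" "H \<notin> full" "pg_mult F H = w"
  using minihyper w_cong not_full_iff unfolding minihyper_def by blast

text \<open>If a hyperplane that is not full contained the axis, the axis would be a single point. A
  hyperplane \<open>K\<close> missing this point cannot be full, so it meets the axis in a point,
  which can only be the axis itself: a contradiction.\<close>

lemma full_iff:
  assumes H: "H \<in> pg_hyperplanes UNIV"
  shows "H \<in> full \<longleftrightarrow> axis \<subseteq> H"
proof
  assume "axis \<subseteq> H"
  show "H \<in> full"
  proof (rule ccontr)
    assume "H \<notin> full"
    then obtain P where P: "P \<in> pg_points H" and "H \<inter> axis = P"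
      by (meson H not_full_Int_axis not_full_point)
    then have dim1: "vec.dim axis = 1"
      using \<open>axis \<subseteq> H\<close> by (auto simp: pg_points_def Int_absorb1)
    obtain v where v: "v \<in> P" "v \<noteq> 0"
      using pg_pointE[OF P] by blast
    obtain K where K: "K \<in> pg_hyperplanes UNIV" "v \<notin> K"
      using hyperplane_separation[of "{0}" UNIV v] v(2) by (auto simp: vec.subspace_UNIV)
    have v_axis: "v \<in> axis"
      using v(1) \<open>H \<inter> axis = P\<close> by blast
    then have "K \<notin> full"
      using K(2) unfolding axis_def by blast
    then obtain Q where Q: "Q \<in> pg_points K" and KQ: "K \<inter> axis = Q"
      by (meson K(1) not_full_Int_axis not_full_point)
    have "Q = axis"
      using Q KQ dim1 subspace_axis by (intro vec.subspace_dim_equal) (auto simp: pg_points_def)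
    then show False
      using KQ v_axis K(2) by blast
  qed
qed (auto simp: axis_def)

text \<open>A hyperplane that is not full meets the axis in a point without containing it, so the
  axis has dimension exactly one more than a point.\<close>

lemma axis_line: "axis \<in> pg_lines UNIV"
proof -
  obtain H where H: "H \<in> pg_hyperplanes UNIV" "H \<notin> full"
    using ex_not_full by blast
  then obtain P where P: "P \<in> pg_points H" and HP: "H \<inter> axis = P"
    by (meson not_full_Int_axis not_full_point)
  have "vec.dim (H \<inter> axis) + 1 = vec.dim axis"
    using H full_iff subspace_axis by (intro dim_Int_hyperplane[OF H(1)]) (auto simp: vec.subspace_UNIV)
  then show ?thesis
    using P HP subspace_axis by (simp add: pg_points_def pg_lines_def)
qed

lemma dim_axis: "vec.dim axis = 2"
  using axis_line by (simp add: pg_lines_def)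

lemma not_full_axis_point:
  assumes H: "H \<in> pg_hyperplanes UNIV" "H \<notin> full"
  obtains "H \<inter> axis \<in> pg_points H" "F (H \<inter> axis) \<ge> 1"
    "\<And>T. T \<in> pg_hyperplanes H \<Longrightarrow>
      [pg_mult F T = n - 1 + of_bool (H \<inter> axis \<subseteq> T)] (mod int p)"
proof -
  obtain P where P: "P \<in> pg_points H" "F P \<ge> 1"
    "\<And>T. T \<in> pg_hyperplanes H \<Longrightarrow> [pg_mult F T = n - 1 + of_bool (P \<subseteq> T)] (mod int p)"
    using not_full_point[OF H] by blast
  moreover have "H \<inter> axis = P"
    using not_full_Int_axis[OF H P(1,3)] by simp
  ultimately show thesis
    using that by simp
qed

text \<open>Each point of the axis is the point of reduction of some hyperplane: take one through
  this point that does not contain the axis.\<close>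

lemma axis_points_positive:
  assumes "P \<in> pg_points axis"
  shows "F P \<ge> 1"
proof -
  have Ps: "vec.subspace P" "P \<subseteq> axis" "vec.dim P = 1"
    using assms by (auto simp: pg_points_def)
  then have "\<not> axis \<subseteq> P"
    using dim_axis vec.dim_subset[of axis P] by linarith
  then obtain y where y: "y \<in> axis" "y \<notin> P"
    by blast
  obtain H where H: "H \<in> pg_hyperplanes UNIV" "P \<subseteq> H" "y \<notin> H"
    using hyperplane_separation[OF Ps(1) vec.subspace_UNIV subset_UNIV UNIV_I y(2)] by blast
  then have "H \<notin> full"
    using y(1) full_iff by blast
  then have Q: "H \<inter> axis \<in> pg_points H" "F (H \<inter> axis) \<ge> 1"
    using not_full_axis_point[OF H(1)] by blast+
  have "P = H \<inter> axis"
    using Ps H(2) Q(1) by (intro vec.subspace_dim_equal) (auto simp: pg_points_def)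
  then show ?thesis
    using Q(2) by simp
qed

lemma card_hyperplane_Int_axis:
  assumes "H \<in> pg_hyperplanes UNIV"
  shows "card (pg_points (H \<inter> axis)) = (if H \<in> full then p + 1 else 1)"
proof (cases "H \<in> full")
  case True
  then have "H \<inter> axis = axis"
    using full_iff[OF assms] by blast
  then show ?thesis
    using True card_pg_points(2)[OF subspace_axis dim_axis] card_field by simp
next
  case False
  then have "H \<inter> axis \<in> pg_points H"
    using not_full_axis_point[OF assms] by blast
  then show ?thesis
    using False by (simp add: pg_points_point)
qed

text \<open>In a full \<open>H\<close>, \<open>T\<close> cuts the axis in a point or contains it,
  which contributes 1 modulo \<open>p\<close> and turns \<open>n - 1\<close> into \<open>n\<close>.
  Otherwise \<open>T\<close> can meet the axis only in the point of reduction of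
  \<open>H\<close>.\<close>

lemma mult_codim2_cong:
  assumes H: "H \<in> pg_hyperplanes UNIV" and T: "T \<in> pg_hyperplanes H"
  shows "[pg_mult F T = n - 1 + int (card (pg_points (T \<inter> axis)))] (mod int p)"
proof (cases "H \<in> full")
  case True
  note Ts = pg_hyperplanesD[OF T]
  have "axis \<subseteq> H"
    using True full_iff[OF H] by simp
  then have "vec.dim axis \<le> vec.dim (T \<inter> axis) + 1"
    using T subspace_axis pg_hyperplanesD[OF H] by (intro dim_le_dim_Int_hyperplane) auto
  moreover have "vec.dim (T \<inter> axis) \<le> vec.dim axis"
    by (rule vec.dim_subset) auto
  ultimately have "vec.dim (T \<inter> axis) = 1 \<or> vec.dim (T \<inter> axis) = 2"
    using dim_axis by linarith
  then have "[int (card (pg_points (T \<inter> axis))) = 1] (mod int p)"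
    using card_pg_points_cong_1[of "T \<inter> axis"] Ts(1) subspace_axis card_field
    by (simp add: vec.subspace_inter)
  then have "[n - 1 + int (card (pg_points (T \<inter> axis))) = n - 1 + 1] (mod int p)"
    by (rule cong_add[OF cong_refl])
  then show ?thesis
    using mult_codim2_full[OF True T] by (simp add: cong_def)
next
  case False
  let ?P = "H \<inter> axis"
  have P: "?P \<in> pg_points H"
    and mult: "[pg_mult F T = n - 1 + of_bool (?P \<subseteq> T)] (mod int p)"
    using not_full_axis_point[OF H False] T by blast+
  have "T \<inter> axis = T \<inter> ?P"
    using pg_hyperplanesD(2)[OF T] by blast
  then have "pg_points (T \<inter> axis) = pg_points T \<inter> {?P}"
    using pg_points_point[OF P] by (simp only: pg_points_Int)
  also have "\<dots> = (if ?P \<subseteq> T then {?P} else {})"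
    using mem_pg_points_subspace[OF P] by auto
  finally show ?thesis
    using mult by (cases "?P \<subseteq> T") simp_all
qed

section \<open>Splitting off the axis, and uniqueness\<close>

lemma v_num_p: "v_num p 2 = int p + 1" "v_num p 1 = 1"
proof -
  have "(int p)\<^sup>2 - 1 = (int p + 1) * (int p - 1)"
    by (simp add: power2_eq_square algebra_simps)
  then show "v_num p 2 = int p + 1" "v_num p 1 = 1"
    using p_ge_2 by (simp_all add: v_num_def)
qed

lemma residual_mult:
  assumes "\<forall>P\<in>pg_points UNIV. F P = F' P + chi (pg_points L) P"
  shows "pg_mult F' S = pg_mult F S - int (card (pg_points (S \<inter> L)))"
proof -
  have "F P = F' P + chi (pg_points L) P" if "P \<in> pg_points S" for P
    using assms that pg_points_mono[of S UNIV] by blast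
  then show ?thesis
    using pg_mult_add_chi[of S F F' L] by simp
qed

text \<open>A hyperplane that is not full loses 1, a full one loses \<open>p + 1\<close>, which its
  multiplicity of at least \<open>w + p\<close> allows. Divisibility holds because hyperplanes and
  their subspaces of codimension 2 are all left with \<open>n - 1\<close> modulo
  \<open>p\<close>.\<close>

lemma axis_residual:
  obtains F' where "\<forall>P\<in>pg_points UNIV. F P = F' P + chi (pg_points axis) P"
    "minihyper UNIV F' (n - v_num p 2) (w - v_num p 1)"
    "\<forall>H\<in>pg_hyperplanes UNIV. \<exists>m u. divisible_minihyper p H F' m u"
proof -
  \<comment> \<open>The truncated subtraction is exact, by positivity on the points of the
    axis.\<close>
  let ?F' = "\<lambda>P. F P - chi (pg_points axis) P"
  have split: "\<forall>P\<in>pg_points UNIV. F P = ?F' P + chi (pg_points axis) P"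
    using axis_points_positive by (auto simp: chi_def)
  note mult = residual_mult[OF split]
  have hyper: "pg_mult ?F' H = pg_mult F H - (if H \<in> full then int p + 1 else 1)"
    if "H \<in> pg_hyperplanes UNIV" for H
    using mult[of H] card_hyperplane_Int_axis[OF that] by (simp split: if_splits)
  have total: "pg_mult ?F' UNIV = n - (int p + 1)"
    using mult[of UNIV] card_pg_points(2)[OF subspace_axis dim_axis] card_field minihyper
    by (simp add: minihyper_def)
  have "pg_mult ?F' H \<ge> w - 1" if H: "H \<in> pg_hyperplanes UNIV" for H
  proof -
    have ge: "pg_mult F H \<ge> w"
      using minihyper H by (simp add: minihyper_def)
    show ?thesis
    proof (cases "H \<in> full")
      case True
      then have "[pg_mult F H = n] (mod (int p)\<^sup>2)"
        by (simp add: full_def)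
      \<comment> \<open>The excess over \<open>w\<close> is nonnegative and congruent to
        \<open>p\<close> modulo the square of \<open>p\<close>, hence at least
        \<open>p\<close>.\<close>
      then have "[pg_mult F H - w = n - (n - int p)] (mod (int p)\<^sup>2)"
        using w_cong by (rule cong_diff)
      then have "(pg_mult F H - w) mod (int p)\<^sup>2 = int p mod (int p)\<^sup>2"
        by (simp add: cong_def)
      also have "\<dots> = int p"
        using p_ge_2 by (intro mod_pos_pos_trivial) (simp_all add: power2_eq_square)
      finally have "pg_mult F H - w \<ge> int p"
        using ge zmod_le_nonneg_dividend[of "pg_mult F H - w" "(int p)\<^sup>2"] by linarith
      then show ?thesis
        using hyper[OF H] True by simp
    next
      case False
      then show ?thesis
        using hyper[OF H] ge by simp
    qed
  qed
  moreover have "\<exists>H\<in>pg_hyperplanes UNIV. pg_mult ?F' H = w - 1"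
  proof -
    obtain H where "H \<in> pg_hyperplanes UNIV" "H \<notin> full" "pg_mult F H = w"
      by (rule ex_not_full)
    then show ?thesis
      using hyper[of H] by (intro bexI[of _ H]) simp_all
  qed
  ultimately have "minihyper UNIV ?F' (n - v_num p 2) (w - v_num p 1)"
    using total unfolding minihyper_def v_num_p by blast
  moreover have "\<exists>m u. divisible_minihyper p H ?F' m u" if H: "H \<in> pg_hyperplanes UNIV" for H
  proof (rule divisible_minihyperI)
    show "vec.subspace H" "vec.dim H \<noteq> 0"
      using pg_hyperplanesD(1)[OF H] dim_hyperplane[OF H] by simp_all
    fix T assume T: "T \<in> pg_hyperplanes H"
    have "[pg_mult ?F' T = n - 1] (mod int p)"
      using mult_codim2_cong[OF H T] unfolding mult by (simp add: cong_iff_dvd_diff algebra_simps)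
    moreover have "[pg_mult ?F' H = n - 1] (mod int p)"
    proof -
      have "[pg_mult F H - (if H \<in> full then int p + 1 else 1) = n - 1] (mod int p)"
        using mult_hyperplane_cong[OF H] by (intro cong_diff) (auto simp: cong_iff_dvd_diff)
      then show ?thesis
        unfolding hyper[OF H] .
    qed
    ultimately show "[pg_mult ?F' T = pg_mult ?F' H] (mod int p)"
      by (meson cong_sym cong_trans)
  qed
  ultimately show thesis
    by (intro that[of ?F'] split ballI)
qed

text \<open>Every hyperplane meets \<open>L\<close> in 1 modulo \<open>p\<close> points, so
  \<open>F'\<close> is \<open>n - 1\<close> modulo \<open>p\<close> on it and, by divisibility, on
  each \<open>T\<close> of codimension 2. Adding \<open>L\<close> back gives the same congruence for
  \<open>L\<close> as for the axis.\<close>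

lemma residual_line_unique:
  assumes L: "L \<in> pg_lines UNIV" and split: "\<forall>P\<in>pg_points UNIV. F P = F' P + chi (pg_points L) P"
    and div: "\<forall>H\<in>pg_hyperplanes UNIV. \<exists>m u. divisible_minihyper p H F' m u"
  shows "L = axis"
proof (rule line_eq_of_codim2_cong[OF L axis_line])
  note mult = residual_mult[OF split]
  have Ls: "vec.subspace L" "vec.dim L = 2"
    using L by (auto simp: pg_lines_def)
  fix H T :: "('a ^ 'n) set"
  assume H: "H \<in> pg_hyperplanes UNIV" and T: "T \<in> pg_hyperplanes H"
  note Hs = pg_hyperplanesD[OF H]
  have "vec.dim (H \<inter> L) \<le> 2"
    using Ls(2) vec.dim_subset[of "H \<inter> L" L] by simp
  moreover have "vec.dim L \<le> vec.dim (H \<inter> L) + 1"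
    using Ls(1) by (intro dim_le_dim_Int_hyperplane[OF H]) (simp_all add: vec.subspace_UNIV)
  ultimately have "vec.dim (H \<inter> L) = 1 \<or> vec.dim (H \<inter> L) = 2"
    using Ls(2) by linarith
  then have "[int (card (pg_points (H \<inter> L))) = 1] (mod int p)"
    using card_pg_points_cong_1[of "H \<inter> L"] Hs(1) Ls(1) card_field
    by (simp add: vec.subspace_inter)
  then have "[pg_mult F' H = n - 1] (mod int p)"
    unfolding mult by (intro cong_diff mult_hyperplane_cong[OF H])
  moreover have "[pg_mult F' T = pg_mult F' H] (mod int p)"
    using div H T unfolding divisible_minihyper_def minihyper_def by fast
  ultimately have "[pg_mult F' T = n - 1] (mod int p)"
    by (meson cong_trans)
  then show "[pg_mult F T = n - 1 + int (card (pg_points (T \<inter> L)))] (mod int CARD('a))"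
    unfolding mult card_field by (simp add: cong_iff_dvd_diff algebra_simps)
  show "[pg_mult F T = n - 1 + int (card (pg_points (T \<inter> axis)))] (mod int CARD('a))"
    using mult_codim2_cong[OF H T] card_field by simp
qed

end

theorem theorem3p1:
  fixes F :: "('a::{field,finite}, 'n::finite) pg_multiset"
    and p r :: nat and n w :: int
  assumes "prime p" and "CARD('a) = p"
    and "r \<ge> 1" and "CARD('n) = r + 1"
    and "minihyper UNIV F n w"
    and "[w = n - int p] (mod (int p)\<^sup>2)"
    and "\<forall>H\<in>pg_hyperplanes UNIV.
           [pg_mult F H = n - int p] (mod (int p)\<^sup>2) \<or> [pg_mult F H = n] (mod (int p)\<^sup>2)"
    and "\<forall>H\<in>pg_hyperplanes UNIV. [pg_mult F H = n - int p] (mod (int p)\<^sup>2) \<longrightarrow>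
           (\<exists>m u. reducible_to (divisible_minihyper p H) H F m u)"
    and "\<forall>H\<in>pg_hyperplanes UNIV. [pg_mult F H = n] (mod (int p)\<^sup>2) \<longrightarrow>
           (\<exists>m u. divisible_minihyper p H F m u)"
  shows "(\<exists>L\<in>pg_lines UNIV. \<exists>F'.
             (\<forall>P\<in>pg_points UNIV. F P = F' P + chi (pg_points L) P) \<and>
             minihyper UNIV F' (n - v_num p 2) (w - v_num p 1)) \<and>
         (\<exists>!L. L \<in> pg_lines UNIV \<and>
           (\<exists>F'. (\<forall>P\<in>pg_points UNIV. F P = F' P + chi (pg_points L) P) \<and>
                 minihyper UNIV F' (n - v_num p 2) (w - v_num p 1) \<and>
                 (\<forall>H\<in>pg_hyperplanes UNIV. \<exists>m u. divisible_minihyper p H F' m u)))"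
proof -
  interpret decomposable_minihyper F p n w
    using assms by unfold_locales auto
  obtain F' where "\<forall>P\<in>pg_points UNIV. F P = F' P + chi (pg_points axis) P"
    "minihyper UNIV F' (n - v_num p 2) (w - v_num p 1)"
    "\<forall>H\<in>pg_hyperplanes UNIV. \<exists>m u. divisible_minihyper p H F' m u"
    by (rule axis_residual)
  then show ?thesis
    \<comment> \<open>The axis witnesses both claims; the first one merely forgets
      divisibility.\<close>
    using axis_line by (intro conjI ex1I[of _ axis]) (blast, blast, blast, elim conjE exE, rule residual_line_unique)
qed

end
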